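(* Let $I$ be an index set, $R>0$, and let $K$ be a compact, convex subset of the space $\Sigma_{R,I}$ of $R$-bounded tracial laws. Then $$h(K)=\sup_{\ell\in K}h(\{\ell\}).$$ Equivalently, $h(K)=\sup_{\ell\in K}h(M_\ell)$, where $M_\ell$ is the tracial von Neumann algebra obtained from the law $\ell$ by the GNS construction and $h(M_\ell):=h(\{\ell\})$ is its $1$-bounded entropy.
   Context: For an index set $I$, $\mathbb{C}^*\langle T_i\mid i\in I\rangle$ is the unital $*$-algebra of noncommutative complex polynomials in free variables $T_i$ and their formal adjoints. For $R>0$, $\Sigma_{R,I}$ is the set of linear functionals $\ell$ on it with $\ell(P^*P)\ge 0$, $\ell(1)=1$, $\ell(PQ)=\ell(QP)$ for all $P,Q$, and $\ell((T_j^*T_j)^k)\le R^{2k}$ for all $k\in\mathbb{N}$, $j\in I$, with the weak-$*$ topology (pointwise convergence). For $A\in M_N(\mathbb{C})^I$ with $\|A_i\|\le R$ for all $i$, let $\ell_A(P)=\frac1N\mathrm{Tr}(P(A))$. For $\mathcal{O}\subset\Sigma_{R,I}$ open, $\Gamma_R^{(N)}(\mathcal{O})=\{A\in M_N(\mathbb{C})^I: \|A_i\|\le R\ \forall i,\ \ell_A\in\mathcal{O}\}$. On $M_N(\mathbb{C})$ let $\|A\|_2=(\frac1N\mathrm{Tr}(A^*A))^{1/2}$. For $\Omega\subset M_N(\mathbb{C})^I$, $F\subset I$ finite, $\epsilon>0$, $K^{\mathrm{orb}}_{F,\epsilon}(\Omega)$ is the minimal cardinality of $\Omega_0\subset\Omega$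 such that for each $C\in\Omega$ there are $B\in\Omega_0$ and $U\in U(N)$ with $\|C_i-UB_iU^*\|_2<\epsilon$ for all $i\in F$. For $K\subset\Sigma_{R,I}$ compact convex, $$h(K)=\sup_{F,\epsilon}\inf_{\mathcal{O}\supset K}\limsup_{N\to\infty}\frac1{N^2}\log K^{\mathrm{orb}}_{F,\epsilon}(\Gamma_R^{(N)}(\mathcal{O})),$$ with $F\subset I$ finite, $\epsilon>0$, $\mathcal{O}$ a weak-$*$ open neighborhood of $K$ in $\Sigma_{R,I}$, and $\log 0=-\infty$. *)

theory Defs
  imports
    "HOL-Library.Poly_Mapping"
    "HOL-Library.Extended_Nat"
    "HOL-Library.Extended_Real"
    "HOL-Library.Liminf_Limsup"
    "HOL-Analysis.Function_Topology"
    "Jordan_Normal_Form.Schur_Decomposition"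
begin

section \<open>Noncommutative *-polynomials\<close>

datatype 'i letter = Var 'i | Adj 'i

primrec letter_index :: "'i letter \<Rightarrow> 'i" where
  "letter_index (Var i) = i"
| "letter_index (Adj i) = i"

primrec letter_star :: "'i letter \<Rightarrow> 'i letter" where
  "letter_star (Var i) = Adj i"
| "letter_star (Adj i) = Var i"

text \<open>
  Words form the free monoid on the letters, written additively: this makes the convolution product
  of finitely supported functions on words the noncommutative product of polynomials.
\<close>

datatype 'i nc_word = Word (letters: "'i letter list")

instantiation nc_word :: (type) monoid_add
begin

definition zero_nc_word :: "'a nc_word" where
  "zero_nc_word = Word []"

definition plus_nc_word :: "'a nc_word \<Rightarrow> 'a nc_word \<Rightarrow> 'a nc_word" where
  "plus_nc_word v w = Word (letters v @ letters w)"

instance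
  by standard (simp_all add: zero_nc_word_def plus_nc_word_def)

end

type_synonym 'i nc_poly = "'i nc_word \<Rightarrow>\<^sub>0 complex"

text \<open>The *-algebra of polynomials in the variables indexed by \<open>I\<close>, as a subset of \<^typ>\<open>'i nc_poly\<close>.\<close>

definition nc_polys :: "'i set \<Rightarrow> 'i nc_poly set" where
  "nc_polys I = {P. \<forall>w \<in> Poly_Mapping.keys P. letter_index ` set (letters w) \<subseteq> I}"

definition nc_const :: "complex \<Rightarrow> 'i nc_poly" where
  "nc_const c = Poly_Mapping.single 0 c"

definition nc_var :: "'i \<Rightarrow> 'i nc_poly" where
  "nc_var i = Poly_Mapping.single (Word [Var i]) 1"

definition word_star :: "'i nc_word \<Rightarrow> 'i nc_word" where
  "word_star w = Word (rev (map letter_star (letters w)))"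

definition nc_star :: "'i nc_poly \<Rightarrow> 'i nc_poly" where
  "nc_star P = (\<Sum>w \<in> Poly_Mapping.keys P.
     Poly_Mapping.single (word_star w) (cnj (Poly_Mapping.lookup P w)))"


section \<open>Bounded tracial laws\<close>

text \<open>
  A functional on the polynomials over \<open>I\<close> is a function that is \<open>undefined\<close> outside
  \<^term>\<open>nc_polys I\<close>. The order on the complex numbers is that of Complex_Order, so
  \<open>0 \<le> z\<close> and \<open>z \<le> r\<close> with \<open>r\<close> real include that \<open>z\<close> is real.
\<close>

definition tracial_laws :: "real \<Rightarrow> 'i set \<Rightarrow> ('i nc_poly \<Rightarrow> complex) set" where
  "tracial_laws R I = {l. l \<in> extensional (nc_polys I) \<and>
     (\<forall>P \<in> nc_polys I. \<forall>Q \<in> nc_polys I. l (P + Q) = l P + l Q) \<and>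
     (\<forall>c. \<forall>P \<in> nc_polys I. l (nc_const c * P) = c * l P) \<and>
     (\<forall>P \<in> nc_polys I. 0 \<le> l (nc_star P * P)) \<and>
     l 1 = 1 \<and>
     (\<forall>P \<in> nc_polys I. \<forall>Q \<in> nc_polys I. l (P * Q) = l (Q * P)) \<and>
     (\<forall>j \<in> I. \<forall>k. l ((nc_star (nc_var j) * nc_var j) ^ k) \<le> complex_of_real (R ^ (2 * k)))}"

text \<open>The weak-* topology: pointwise convergence on the polynomials over \<open>I\<close>.\<close>

definition law_topology :: "real \<Rightarrow> 'i set \<Rightarrow> ('i nc_poly \<Rightarrow> complex) topology" where
  "law_topology R I =
     subtopology (product_topology (\<lambda>_. euclidean) (nc_polys I)) (tracial_laws R I)"

definition convex_laws :: "'i set \<Rightarrow> ('i nc_poly \<Rightarrow> complex) set \<Rightarrow> bool" where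
  "convex_laws I K \<longleftrightarrow> (\<forall>l \<in> K. \<forall>m \<in> K. \<forall>t. 0 \<le> t \<and> t \<le> 1 \<longrightarrow>
     (\<lambda>P \<in> nc_polys I. complex_of_real (1 - t) * l P + complex_of_real t * m P) \<in> K)"


section \<open>Matrices\<close>

definition mat_trace :: "complex mat \<Rightarrow> complex" where
  "mat_trace A = (\<Sum>i < dim_row A. A $$ (i, i))"

definition vec_norm2 :: "complex vec \<Rightarrow> real" where
  "vec_norm2 v = sqrt (Re (v \<bullet>c v))"

definition op_norm :: "complex mat \<Rightarrow> real" where
  "op_norm A = Sup {vec_norm2 (A *\<^sub>v v) |v. v \<in> carrier_vec (dim_col A) \<and> vec_norm2 v \<le> 1}"

definition norm_tr2 :: "nat \<Rightarrow> complex mat \<Rightarrow> real" where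
  "norm_tr2 N A = sqrt (1 / real N * Re (mat_trace (mat_adjoint A * A)))"

definition unitaries :: "nat \<Rightarrow> complex mat set" where
  "unitaries N = {U \<in> carrier_mat N N. mat_adjoint U * U = 1\<^sub>m N \<and> U * mat_adjoint U = 1\<^sub>m N}"

primrec eval_letter :: "('i \<Rightarrow> complex mat) \<Rightarrow> 'i letter \<Rightarrow> complex mat" where
  "eval_letter A (Var i) = A i"
| "eval_letter A (Adj i) = mat_adjoint (A i)"

definition eval_word :: "nat \<Rightarrow> ('i \<Rightarrow> complex mat) \<Rightarrow> 'i nc_word \<Rightarrow> complex mat" where
  "eval_word N A w = foldr (\<lambda>x M. eval_letter A x * M) (letters w) (1\<^sub>m N)"

text \<open>The sum over the monomials is taken entrywise, since matrices of fixed size are not a type.\<close>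

definition eval_poly_mat :: "nat \<Rightarrow> ('i \<Rightarrow> complex mat) \<Rightarrow> 'i nc_poly \<Rightarrow> complex mat" where
  "eval_poly_mat N A P = mat N N (\<lambda>rc.
     \<Sum>w \<in> Poly_Mapping.keys P. Poly_Mapping.lookup P w * eval_word N A w $$ rc)"

definition mat_law :: "'i set \<Rightarrow> nat \<Rightarrow> ('i \<Rightarrow> complex mat) \<Rightarrow> ('i nc_poly \<Rightarrow> complex)" where
  "mat_law I N A =
     (\<lambda>P \<in> nc_polys I. complex_of_real (1 / real N) * mat_trace (eval_poly_mat N A P))"


section \<open>Microstates, orbital covering numbers and entropy\<close>

definition microstates ::
    "real \<Rightarrow> 'i set \<Rightarrow> nat \<Rightarrow> ('i nc_poly \<Rightarrow> complex) set \<Rightarrow> ('i \<Rightarrow> complex mat) set" where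
  "microstates R I N O' =
     {A \<in> I \<rightarrow>\<^sub>E carrier_mat N N. (\<forall>i \<in> I. op_norm (A i) \<le> R) \<and> mat_law I N A \<in> O'}"

definition orb_cover ::
    "nat \<Rightarrow> 'i set \<Rightarrow> real \<Rightarrow> ('i \<Rightarrow> complex mat) set \<Rightarrow> ('i \<Rightarrow> complex mat) set \<Rightarrow> bool" where
  "orb_cover N F \<epsilon> \<Omega> \<Omega>\<^sub>0 \<longleftrightarrow> (\<forall>C \<in> \<Omega>. \<exists>B \<in> \<Omega>\<^sub>0. \<exists>U \<in> unitaries N.
     \<forall>i \<in> F. norm_tr2 N (C i - U * B i * mat_adjoint U) < \<epsilon>)"

text \<open>The minimal cardinality; it would be \<open>\<infinity>\<close> if there were no finite \<open>\<Omega>\<^sub>0\<close>.\<close>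

definition orb_covering_number ::
    "nat \<Rightarrow> 'i set \<Rightarrow> real \<Rightarrow> ('i \<Rightarrow> complex mat) set \<Rightarrow> enat" where
  "orb_covering_number N F \<epsilon> \<Omega> =
     (INF \<Omega>\<^sub>0 \<in> {\<Omega>\<^sub>0. \<Omega>\<^sub>0 \<subseteq> \<Omega> \<and> finite \<Omega>\<^sub>0 \<and> orb_cover N F \<epsilon> \<Omega> \<Omega>\<^sub>0}. enat (card \<Omega>\<^sub>0))"

definition log_enat :: "enat \<Rightarrow> ereal" where
  "log_enat k = (case k of enat n \<Rightarrow> (if n = 0 then -\<infinity> else ereal (ln (real n))) | \<infinity> \<Rightarrow> \<infinity>)"

definition law_entropy :: "real \<Rightarrow> 'i set \<Rightarrow> ('i nc_poly \<Rightarrow> complex) set \<Rightarrow> ereal" where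
  "law_entropy R I K =
     (SUP (F, \<epsilon>) \<in> {(F, \<epsilon>). finite F \<and> F \<subseteq> I \<and> (0 :: real) < \<epsilon>}.
      INF O' \<in> {O'. openin (law_topology R I) O' \<and> K \<subseteq> O'}.
        limsup (\<lambda>N. ereal (1 / (real N)\<^sup>2) *
                     log_enat (orb_covering_number N F \<epsilon> (microstates R I N O'))))"

text \<open>
  The 1-bounded entropy of the tracial von Neumann algebra generated by \<open>l\<close> through the GNS
  construction; by convention it is the entropy of the law \<open>l\<close>, so the algebra itself is not built.
\<close>

definition one_bounded_entropy :: "real \<Rightarrow> 'i set \<Rightarrow> ('i nc_poly \<Rightarrow> complex) \<Rightarrow> ereal" where
  "one_bounded_entropy R I l = law_entropy R I {l}"

end

theory Submission
  imports Defs
begin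

text \<open>
  Fix a finite set \<open>F\<close> of variables and a scale \<open>\<epsilon>\<close>, and let \<open>h\<^sub>F\<^sub>,\<^sub>\<epsilon>(K)\<close> be the infimum over the
  neighbourhoods of \<open>K\<close> in the definition of \<open>h(K)\<close>. The formula already holds at each such
  resolution, \<open>h\<^sub>F\<^sub>,\<^sub>\<epsilon>(K) = sup\<^sub>\<ell> h\<^sub>F\<^sub>,\<^sub>\<epsilon>({\<ell>})\<close> (lemma \<open>entropy_at_compact\<close>), and the theorem follows by
  exchanging the supremum over \<open>(F, \<epsilon>)\<close> with the one over \<open>\<ell>\<close>.

  One inequality holds because every neighbourhood of \<open>K\<close> is a neighbourhood of each of its points.
  For the other, take a real \<open>c\<close> above all the \<open>h\<^sub>F\<^sub>,\<^sub>\<epsilon>({\<ell>})\<close> and give every \<open>\<ell>\<close> in \<open>K\<close> an open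
  neighbourhood whose microstates have covering rate below \<open>c\<close>. Finitely many of these
  neighbourhoods cover \<open>K\<close>. Their union is a neighbourhood of \<open>K\<close>, its microstate space is the union
  of theirs, and covering numbers are subadditive (lemma \<open>orb_covering_number_UN_le\<close>). So
  the covering number for the union is, for large \<open>N\<close>, at most a fixed multiple of \<open>exp (c N\<^sup>2)\<close>. The
  factor is the number of neighbourhoods; it disappears from the exponential growth rate at speed
  \<open>N\<^sup>2\<close> (lemma \<open>covering_rate_UN_le\<close>).
\<close>

section \<open>Subadditivity of orbital covering numbers\<close>

lemma orb_covering_number_le:
  assumes "\<Omega>\<^sub>0 \<subseteq> \<Omega>" "finite \<Omega>\<^sub>0" "orb_cover N F \<epsilon> \<Omega> \<Omega>\<^sub>0"
  shows "orb_covering_number N F \<epsilon> \<Omega> \<le> enat (card \<Omega>\<^sub>0)"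
  unfolding orb_covering_number_def using assms by (intro INF_lower) auto

lemma orb_covering_number_attained:
  assumes "orb_covering_number N F \<epsilon> \<Omega> = enat n"
  obtains \<Omega>\<^sub>0 where "\<Omega>\<^sub>0 \<subseteq> \<Omega>" "finite \<Omega>\<^sub>0" "orb_cover N F \<epsilon> \<Omega> \<Omega>\<^sub>0" "card \<Omega>\<^sub>0 = n"
proof -
  let ?C = "{\<Omega>\<^sub>0. \<Omega>\<^sub>0 \<subseteq> \<Omega> \<and> finite \<Omega>\<^sub>0 \<and> orb_cover N F \<epsilon> \<Omega> \<Omega>\<^sub>0}"
  have "?C \<noteq> {}"
  proof
    assume "?C = {}"
    then have "orb_covering_number N F \<epsilon> \<Omega> = \<infinity>"
      unfolding orb_covering_number_def by (simp only: image_empty Inf_empty top_enat_def)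
    with assms show False by simp
  qed
  then obtain \<Omega>\<^sub>1 where "\<Omega>\<^sub>1 \<in> ?C" by blast
  then have "Inf ((\<lambda>\<Omega>\<^sub>0. enat (card \<Omega>\<^sub>0)) ` ?C) \<in> (\<lambda>\<Omega>\<^sub>0. enat (card \<Omega>\<^sub>0)) ` ?C"
    by (intro wellorder_InfI) (rule imageI)
  then show ?thesis
    using assms that unfolding orb_covering_number_def by auto
qed

lemma orb_covering_number_empty: "orb_covering_number N (F :: 'a set) \<epsilon> {} = 0"
proof -
  have "orb_covering_number N F \<epsilon> {} \<le> enat (card ({} :: ('a \<Rightarrow> complex mat) set))"
    by (rule orb_covering_number_le) (auto simp: orb_cover_def)
  then show ?thesis by (simp add: zero_enat_def [symmetric])
qed

text \<open>
  The union of two optimal coverings is a covering of the union: covering centres have to lie in the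
  covered set, and this persists in a larger set.
\<close>

lemma orb_covering_number_Un_le:
  "orb_covering_number N F \<epsilon> (\<Omega> \<union> \<Omega>') \<le> orb_covering_number N F \<epsilon> \<Omega> + orb_covering_number N F \<epsilon> \<Omega>'"
proof (cases "orb_covering_number N F \<epsilon> \<Omega>"; cases "orb_covering_number N F \<epsilon> \<Omega>'")
  fix m n
  assume mn: "orb_covering_number N F \<epsilon> \<Omega> = enat m" "orb_covering_number N F \<epsilon> \<Omega>' = enat n"
  obtain A where A: "A \<subseteq> \<Omega>" "finite A" "orb_cover N F \<epsilon> \<Omega> A" "card A = m"
    using mn(1) by (rule orb_covering_number_attained)
  obtain B where B: "B \<subseteq> \<Omega>'" "finite B" "orb_cover N F \<epsilon> \<Omega>' B" "card B = n"
    using mn(2) by (rule orb_covering_number_attained)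
  have "orb_cover N F \<epsilon> (\<Omega> \<union> \<Omega>') (A \<union> B)"
    using A(3) B(3) unfolding orb_cover_def by blast
  then have "orb_covering_number N F \<epsilon> (\<Omega> \<union> \<Omega>') \<le> enat (card (A \<union> B))"
    using A B by (intro orb_covering_number_le) auto
  also have "\<dots> \<le> enat (m + n)"
    using card_Un_le [of A B] A(4) B(4) by simp
  finally show ?thesis by (simp add: mn)
qed auto

lemma orb_covering_number_UN_le:
  assumes "finite J"
  shows "orb_covering_number N F \<epsilon> (\<Union>j\<in>J. \<Omega> j) \<le> (\<Sum>j\<in>J. orb_covering_number N F \<epsilon> (\<Omega> j))"
  using assms
proof (induction J rule: finite_induct)
  case empty
  then show ?case by (simp add: orb_covering_number_empty)
next
  case (insert x J)
  then show ?case
    using order_trans [OF orb_covering_number_Un_le add_left_mono [OF insert.IH]] by simp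
qed

section \<open>Growth rates\<close>

lemma log_enat_le_iff: "log_enat k \<le> ereal x \<longleftrightarrow> (\<exists>n. k = enat n \<and> real n \<le> exp x)"
proof (cases k)
  case (enat n)
  have "ln (real n) \<le> x \<longleftrightarrow> real n \<le> exp x" if "n \<noteq> 0"
    using that exp_le_cancel_iff [of "ln (real n)" x] by simp
  then show ?thesis by (auto simp: log_enat_def enat)
qed (simp add: log_enat_def)

text \<open>
  Bounds on the normalised logarithm become bounds on the covering number itself, which is the form
  in which subadditivity applies.
\<close>

lemma scaled_log_enat_le_iff:
  assumes "N > 0"
  shows "ereal (1 / (real N)\<^sup>2) * log_enat k \<le> ereal c
         \<longleftrightarrow> (\<exists>n. k = enat n \<and> real n \<le> exp (c * (real N)\<^sup>2))"
proof -
  have "ereal (1 / (real N)\<^sup>2) * log_enat k \<le> ereal c \<longleftrightarrow> log_enat k \<le> ereal (c * (real N)\<^sup>2)"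
    using assms by (cases "log_enat k") (auto simp: field_simps)
  then show ?thesis by (simp add: log_enat_le_iff)
qed

definition covering_rate ::
    "real \<Rightarrow> 'i set \<Rightarrow> 'i set \<Rightarrow> real \<Rightarrow> ('i nc_poly \<Rightarrow> complex) set \<Rightarrow> ereal" where
  "covering_rate R I F \<epsilon> O' = limsup (\<lambda>N. ereal (1 / (real N)\<^sup>2) *
     log_enat (orb_covering_number N F \<epsilon> (microstates R I N O')))"

lemma microstates_UN: "microstates R I N (\<Union>j\<in>J. O' j) = (\<Union>j\<in>J. microstates R I N (O' j))"
  unfolding microstates_def by blast

text \<open>
  A sum of \<open>m\<close> quantities bounded by \<open>exp (c N\<^sup>2)\<close> is at most \<open>exp (c' N\<^sup>2)\<close> for any \<open>c' > c\<close> once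
  \<open>ln m \<le> (c' - c) N\<^sup>2\<close>.
\<close>

lemma covering_rate_UN_le:
  assumes "finite J" and rate: "\<And>j. j \<in> J \<Longrightarrow> covering_rate R I F \<epsilon> (O' j) < ereal c"
  shows "covering_rate R I F \<epsilon> (\<Union>j\<in>J. O' j) \<le> ereal c"
proof (rule ereal_le_epsilon2)
  fix d :: real
  assume "d > 0"
  let ?k = "\<lambda>N j. orb_covering_number N F \<epsilon> (microstates R I N (O' j))"
  have "\<forall>\<^sub>F N in sequentially. \<forall>j\<in>J. ereal (1 / (real N)\<^sup>2) * log_enat (?k N j) < ereal c"
    using assms unfolding covering_rate_def by (intro eventually_ball_finite ballI Limsup_lessD) auto
  moreover have "\<forall>\<^sub>F N in sequentially. real (card J) \<le> exp (d * (real N)\<^sup>2)"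
  proof -
    have "\<forall>\<^sub>F N in sequentially. real (card J) / d \<le> real N"
      by (rule eventually_sequentiallyI [of "nat \<lceil>real (card J) / d\<rceil>"]) linarith
    with eventually_gt_at_top [of "0::nat"] show ?thesis
    proof eventually_elim
      case (elim N)
      have "real (card J) \<le> d * real N"
        using elim \<open>d > 0\<close> by (simp add: field_simps)
      also have "\<dots> \<le> d * (real N)\<^sup>2"
        using elim \<open>d > 0\<close> by (simp add: power2_eq_square)
      also have "\<dots> \<le> exp (d * (real N)\<^sup>2)"
        using exp_ge_add_one_self [of "d * (real N)\<^sup>2"] by linarith
      finally show ?case .
    qed
  qed
  ultimately have "\<forall>\<^sub>F N in sequentially. ereal (1 / (real N)\<^sup>2) *
      log_enat (orb_covering_number N F \<epsilon> (microstates R I N (\<Union>j\<in>J. O' j))) \<le> ereal (c + d)"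
    using eventually_gt_at_top [of "0::nat"]
  proof eventually_elim
    case (elim N)
    have "\<forall>j\<in>J. \<exists>n. ?k N j = enat n \<and> real n \<le> exp (c * (real N)\<^sup>2)"
      using elim(1) by (simp add: less_imp_le flip: scaled_log_enat_le_iff [OF elim(3)])
    then obtain n where n: "\<And>j. j \<in> J \<Longrightarrow> ?k N j = enat (n j)"
      and n_le: "\<And>j. j \<in> J \<Longrightarrow> real (n j) \<le> exp (c * (real N)\<^sup>2)"
      by metis
    have "orb_covering_number N F \<epsilon> (microstates R I N (\<Union>j\<in>J. O' j)) \<le> (\<Sum>j\<in>J. ?k N j)"
      unfolding microstates_UN by (rule orb_covering_number_UN_le [OF \<open>finite J\<close>])
    also have "\<dots> = enat (\<Sum>j\<in>J. n j)"
      using n by (simp flip: of_nat_eq_enat)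
    finally obtain m
      where m: "orb_covering_number N F \<epsilon> (microstates R I N (\<Union>j\<in>J. O' j)) = enat m"
        and m_le: "m \<le> (\<Sum>j\<in>J. n j)"
      by (metis enat_ile enat_ord_simps(1))
    have "real m \<le> (\<Sum>j\<in>J. real (n j))"
      using m_le by (simp flip: of_nat_sum)
    also have "\<dots> \<le> real (card J) * exp (c * (real N)\<^sup>2)"
      using n_le by (intro sum_bounded_above)
    also have "\<dots> \<le> exp (d * (real N)\<^sup>2) * exp (c * (real N)\<^sup>2)"
      using elim(2) by (intro mult_right_mono) auto
    also have "\<dots> = exp ((c + d) * (real N)\<^sup>2)"
      by (simp add: algebra_simps flip: exp_add)
    finally show ?case
      using m elim(3) by (simp only: scaled_log_enat_le_iff) blast
  qed
  then show "covering_rate R I F \<epsilon> (\<Union>j\<in>J. O' j) \<le> ereal c + ereal d"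
    unfolding covering_rate_def by (simp add: Limsup_bounded)
qed

section \<open>Entropy of compact sets of laws\<close>

definition entropy_at ::
    "real \<Rightarrow> 'i set \<Rightarrow> 'i set \<Rightarrow> real \<Rightarrow> ('i nc_poly \<Rightarrow> complex) set \<Rightarrow> ereal" where
  "entropy_at R I F \<epsilon> K =
     (INF O' \<in> {O'. openin (law_topology R I) O' \<and> K \<subseteq> O'}. covering_rate R I F \<epsilon> O')"

lemma law_entropy_eq_SUP_entropy_at:
  "law_entropy R I K =
     (SUP (F, \<epsilon>) \<in> {(F, \<epsilon>). finite F \<and> F \<subseteq> I \<and> (0 :: real) < \<epsilon>}. entropy_at R I F \<epsilon> K)"
  unfolding law_entropy_def entropy_at_def covering_rate_def ..

lemma entropy_at_mono: "L \<subseteq> K \<Longrightarrow> entropy_at R I F \<epsilon> L \<le> entropy_at R I F \<epsilon> K"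
  unfolding entropy_at_def by (rule INF_superset_mono) auto

text \<open>
  Compactness reduces a neighbourhood of \<open>K\<close> to finitely many neighbourhoods of points, chosen well
  for each point separately.
\<close>

lemma entropy_at_compact:
  assumes "compactin (law_topology R I) K"
  shows "entropy_at R I F \<epsilon> K = (SUP l\<in>K. entropy_at R I F \<epsilon> {l})"
proof (rule antisym)
  show "(SUP l\<in>K. entropy_at R I F \<epsilon> {l}) \<le> entropy_at R I F \<epsilon> K"
    by (intro SUP_least entropy_at_mono) auto
  show "entropy_at R I F \<epsilon> K \<le> (SUP l\<in>K. entropy_at R I F \<epsilon> {l})"
  proof (rule ereal_le_real)
    fix c
    assume "(SUP l\<in>K. entropy_at R I F \<epsilon> {l}) \<le> ereal c"
    then have le: "entropy_at R I F \<epsilon> {l} \<le> ereal c" if "l \<in> K" for l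
      using that by (simp add: SUP_le_iff)
    show "entropy_at R I F \<epsilon> K \<le> ereal c"
    proof (rule ereal_le_epsilon2)
      fix d :: real
      assume "d > 0"
      have "\<forall>l\<in>K. \<exists>O'. openin (law_topology R I) O' \<and> l \<in> O' \<and>
              covering_rate R I F \<epsilon> O' < ereal (c + d)"
      proof
        fix l
        assume "l \<in> K"
        then have "entropy_at R I F \<epsilon> {l} < ereal (c + d)"
          using \<open>d > 0\<close> by (intro le_less_trans [OF le]) auto
        then show "\<exists>O'. openin (law_topology R I) O' \<and> l \<in> O' \<and>
              covering_rate R I F \<epsilon> O' < ereal (c + d)"
          unfolding entropy_at_def INF_less_iff by auto
      qed
      then obtain W where W: "\<And>l. l \<in> K \<Longrightarrow> openin (law_topology R I) (W l)"
          "\<And>l. l \<in> K \<Longrightarrow> l \<in> W l" "\<And>l. l \<in> K \<Longrightarrow> covering_rate R I F \<epsilon> (W l) < ereal (c + d)"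
        by metis
      have "\<exists>\<F>. finite \<F> \<and> \<F> \<subseteq> W ` K \<and> K \<subseteq> \<Union>\<F>"
        using W(1,2) by (intro compactinD [OF assms]) (blast, blast)
      then obtain L where L: "finite L" "L \<subseteq> K" "K \<subseteq> (\<Union>l\<in>L. W l)"
        by (metis finite_subset_image)
      have "entropy_at R I F \<epsilon> K \<le> covering_rate R I F \<epsilon> (\<Union>l\<in>L. W l)"
        unfolding entropy_at_def using L W by (intro INF_lower) auto
      also have "\<dots> \<le> ereal (c + d)"
        using L W by (intro covering_rate_UN_le) auto
      finally show "entropy_at R I F \<epsilon> K \<le> ereal c + ereal d" by simp
    qed
  qed
qed

theorem theorem6p1:
  fixes I :: "'i set" and R :: real and K :: "('i nc_poly \<Rightarrow> complex) set"
  assumes "R > 0"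
    and "compactin (law_topology R I) K"
    and "convex_laws I K"
  shows "law_entropy R I K = (SUP l\<in>K. law_entropy R I {l}) \<and>
         law_entropy R I K = (SUP l\<in>K. one_bounded_entropy R I l)"
proof -
  have "law_entropy R I K = (SUP l\<in>K. law_entropy R I {l})"
    unfolding law_entropy_eq_SUP_entropy_at entropy_at_compact [OF assms(2)] case_prod_unfold
    by (rule SUP_commute)
  then show ?thesis by (simp add: one_bounded_entropy_def)
qed

end
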